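(* Let $G$ be a finite connected graph of diameter $D(G) \geq 4$. Then $c(G) \leq \alpha(G)-1$, where $c(G)$ is the cop number of $G$ and $\alpha(G)$ is the independence number of $G$.
   Context: The game of Cops and Robbers on a finite undirected graph $G$: one player controls $k$ cops and the other a single robber. First the cops choose starting vertices (several cops may share a vertex), then the robber chooses a starting vertex. Players then alternate turns, beginning with the cops; on the cops' turn each cop moves to a vertex at distance at most $1$ from its current vertex, and on the robber's turn the robber does likewise. The cops win if at some point the robber occupies the same vertex as some cop; otherwise the robber wins. The cop number $c(G)$ is the minimum $k$ such that $k$ cops have a winning strategy. $\alpha(G)$ is the maximum size of an independent set of $G$, and $D(G)$ is the diameter (maximum distance between two vertices) of $G$. *)

theory Defs
  imports "Graph_Theory.Graph_Theory" "HOL-Library.Extended_Nat"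
begin

(* Undirected simple graphs are the finite symmetric digraphs without loops and
   parallel arcs, i.e. the locale graph of Graph_Theory. *)

(* The value is \<infinity> if v is not reachable from u. *)
definition gdist :: "('a, 'b) pre_digraph \<Rightarrow> 'a \<Rightarrow> 'a \<Rightarrow> enat" where
  "gdist G u v = (INF p \<in> {p. pre_digraph.awalk G u p v}. enat (length p))"

definition diameter :: "('a, 'b) pre_digraph \<Rightarrow> enat" where
  "diameter G = (SUP u \<in> verts G. SUP v \<in> verts G. gdist G u v)"

definition independent_set :: "('a, 'b) pre_digraph \<Rightarrow> 'a set \<Rightarrow> bool" where
  "independent_set G S \<longleftrightarrow> S \<subseteq> verts G \<and> (\<forall>u\<in>S. \<forall>v\<in>S. \<not> u \<rightarrow>\<^bsub>G\<^esub> v)"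

definition independence_number :: "('a, 'b) pre_digraph \<Rightarrow> nat" where
  "independence_number G = Max (card ` {S. independent_set G S})"

(* r 0 is the robber's starting vertex, r n his vertex after n of his moves.  He sees
   everything, but against a fixed deterministic cop strategy this amounts to
   quantifying over all such trajectories. *)
definition robber_play :: "('a, 'b) pre_digraph \<Rightarrow> (nat \<Rightarrow> 'a) \<Rightarrow> bool" where
  "robber_play G r \<longleftrightarrow> (\<forall>n. r n \<in> verts G \<and> gdist G (r n) (r (Suc n)) \<le> 1)"

(* A strategy for k cops maps the list of all robber positions so far to the cops' next
   placement, cop i < k being put on s h i; the cops' own past positions are determined
   by s and h.  In particular s [] is the starting placement, chosen before the robber
   is placed, and s [r 0, ..., r n] is the placement after the cops' move number n + 1. *)
definition cop_strategy ::
  "('a, 'b) pre_digraph \<Rightarrow> nat \<Rightarrow> ('a list \<Rightarrow> nat \<Rightarrow> 'a) \<Rightarrow> bool" where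
  "cop_strategy G k s \<longleftrightarrow>
     (\<forall>i<k. s [] i \<in> verts G) \<and>
     (\<forall>r. robber_play G r \<longrightarrow>
       (\<forall>n. \<forall>i<k. gdist G (s (map r [0..<n]) i) (s (map r [0..<Suc n]) i) \<le> 1))"

(* The first disjunct is a meeting right after the robber has been placed or has moved
   to r n, the second one a meeting right after the cops' reply.  Plays are continued
   formally after a capture; this does not matter, since every player may stay put. *)
definition captured :: "nat \<Rightarrow> ('a list \<Rightarrow> nat \<Rightarrow> 'a) \<Rightarrow> (nat \<Rightarrow> 'a) \<Rightarrow> bool" where
  "captured k s r \<longleftrightarrow>
     (\<exists>n. \<exists>i<k. s (map r [0..<n]) i = r n \<or> s (map r [0..<Suc n]) i = r n)"

definition cops_win :: "('a, 'b) pre_digraph \<Rightarrow> nat \<Rightarrow> bool" where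
  "cops_win G k \<longleftrightarrow>
     (\<exists>s. cop_strategy G k s \<and> (\<forall>r. robber_play G r \<longrightarrow> captured k s r))"

definition cop_number :: "('a, 'b) pre_digraph \<Rightarrow> nat" where
  "cop_number G = (LEAST k. cops_win G k)"

lemma gdist_le_iff:
  "gdist G u v \<le> enat n \<longleftrightarrow> (\<exists>p. pre_digraph.awalk G u p v \<and> length p \<le> n)"
proof
  assume le: "gdist G u v \<le> enat n"
  let ?A = "(\<lambda>p. enat (length p)) ` {p. pre_digraph.awalk G u p v}"
  have "?A \<noteq> {}"
  proof
    assume "?A = {}"
    then have "gdist G u v = \<infinity>"
      unfolding gdist_def by (simp only: Inf_enat_def simp_thms if_True)
    with le show False by simp
  qed
  then have "Inf ?A \<in> ?A"
    unfolding Inf_enat_def using LeastI_ex[of "\<lambda>x. x \<in> ?A"] by auto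
  with le show "\<exists>p. pre_digraph.awalk G u p v \<and> length p \<le> n"
    by (auto simp: gdist_def)
next
  assume "\<exists>p. pre_digraph.awalk G u p v \<and> length p \<le> n"
  then show "gdist G u v \<le> enat n"
    unfolding gdist_def by (force intro: INF_lower2)
qed

lemma gdist_le_1_iff:
  assumes "wf_digraph G"
  shows "gdist G u v \<le> 1 \<longleftrightarrow> u \<in> verts G \<and> (v = u \<or> u \<rightarrow>\<^bsub>G\<^esub> v)"
proof -
  interpret wf_digraph G by fact
  have "gdist G u v \<le> 1 \<longleftrightarrow> (\<exists>p. awalk u p v \<and> length p \<le> 1)"
    using gdist_le_iff[of G u v 1] by (simp add: one_enat_def)
  also have "\<dots> \<longleftrightarrow> awalk u [] v \<or> (\<exists>e. awalk u [e] v)"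
    by (auto simp: le_Suc_eq length_Suc_conv)
  also have "\<dots> \<longleftrightarrow> u \<in> verts G \<and> (v = u \<or> u \<rightarrow>\<^bsub>G\<^esub> v)"
    by (auto simp: awalk_def arcs_ends_conv image_iff)
  finally show ?thesis .
qed

(* Hence the minimum defining the cop number is attained. *)
lemma cops_win_card_verts:
  assumes "fin_digraph G"
  shows "cops_win G (card (verts G))"
proof -
  interpret fin_digraph G by fact
  obtain f where f: "bij_betw f {..<card (verts G)} (verts G)"
    using ex_bij_betw_nat_finite[OF finite_verts] by (auto simp: atLeast0LessThan)
  have "cop_strategy G (card (verts G)) (\<lambda>_. f)"
    using bij_betwE[OF f] by (auto simp: cop_strategy_def gdist_le_1_iff[OF wf_digraph_axioms])
  moreover have "captured (card (verts G)) (\<lambda>_. f) r" if "robber_play G r" for r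
  proof -
    have "r 0 \<in> f ` {..<card (verts G)}"
      using that f by (auto simp: robber_play_def bij_betw_def)
    then obtain i where "i < card (verts G)" "f i = r 0" by auto
    then show ?thesis unfolding captured_def by blast
  qed
  ultimately show ?thesis unfolding cops_win_def by blast
qed

end

theory Submission
  imports Defs
begin

text \<open>
  Let \<open>u\<close> and \<open>v\<close> be at distance at least 4 and extend \<open>{u, v}\<close> to a maximal independent set
  \<open>S\<close>.  One cop stays on each vertex of \<open>S - {u, v}\<close>, and one more cop starts on \<open>u\<close> and walks
  to \<open>v\<close>.  Since \<open>S\<close> is dominating, a robber who keeps out of reach of the stationary cops stays
  in the union of the closed neighbourhoods of \<open>u\<close> and \<open>v\<close>.  There is no edge between these two,
  and the walking cop forbids a start near \<open>u\<close>, so the robber is confined to the neighbourhood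
  of \<open>v\<close> and is caught when the walking cop arrives there.
\<close>

lemma gdist_triangle_le:
  assumes "wf_digraph G" "gdist G u v \<le> enat m" "gdist G v w \<le> enat n"
  shows "gdist G u w \<le> enat (m + n)"
proof -
  interpret wf_digraph G by fact
  obtain p q where "awalk u p v" "length p \<le> m" "awalk v q w" "length q \<le> n"
    using assms(2,3) by (auto simp: gdist_le_iff)
  then have "awalk u (p @ q) w" "length (p @ q) \<le> m + n"
    by (auto intro: awalk_appendI)
  then show ?thesis
    unfolding gdist_le_iff by blast
qed

lemma gdist_le_1_sym:
  assumes "sym_digraph G" "gdist G u v \<le> 1"
  shows "gdist G v u \<le> 1"
proof -
  interpret sym_digraph G by fact
  show ?thesis
    using assms(2) arcs_ends_symmetric[OF sym_arcs] adj_in_verts(2)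
    by (auto simp: gdist_le_1_iff[OF wf_digraph_axioms])
qed

text \<open>If all distances were at most \<open>n\<close>, their supremum would be too. Arguing
  with this bound avoids asking whether the diameter is finite or attained.\<close>

lemma ex_far_vertices:
  assumes "diameter G \<ge> enat (Suc n)"
  obtains u v where "u \<in> verts G" "v \<in> verts G" "\<not> gdist G u v \<le> enat n"
proof (rule ccontr)
  assume "\<not> thesis"
  then have "diameter G \<le> enat n"
    unfolding diameter_def using that by (auto intro!: SUP_least)
  from order.trans[OF assms this] show False by simp
qed

text \<open>Take \<open>S\<close> maximal among the independent sets containing \<open>A\<close>. As
  there are no loops, a vertex neither in \<open>S\<close> nor adjacent to it could be added,
  contradicting maximality.\<close>

lemma independent_set_extend_dominating:
  assumes "graph G" "independent_set G A"
  obtains S where "A \<subseteq> S" "independent_set G S"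
    "\<And>x. x \<in> verts G \<Longrightarrow> \<exists>y\<in>S. gdist G y x \<le> 1"
proof -
  interpret graph G by fact
  have fin: "finite {S. independent_set G S}"
    by (rule finite_subset[of _ "Pow (verts G)"]) (auto simp: independent_set_def)
  from finite_has_maximal2[OF fin, of A] assms(2)
  obtain S where S: "independent_set G S" "A \<subseteq> S"
    and max: "\<And>T. independent_set G T \<Longrightarrow> S \<subseteq> T \<Longrightarrow> S = T"
    by auto
  have "\<exists>y\<in>S. gdist G y x \<le> 1" if x: "x \<in> verts G" for x
  proof (rule ccontr)
    assume contra: "\<not> (\<exists>y\<in>S. gdist G y x \<le> 1)"
    then have far: "\<not> y \<rightarrow>\<^bsub>G\<^esub> x \<and> \<not> x \<rightarrow>\<^bsub>G\<^esub> y \<and> y \<noteq> x" if "y \<in> S" for y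
      using that x arcs_ends_symmetric[OF sym_arcs] adj_in_verts
      by (auto simp: gdist_le_1_iff[OF wf_digraph_axioms])
    have "\<not> x \<rightarrow>\<^bsub>G\<^esub> x"
      using adj_not_same by blast
    then have "independent_set G (insert x S)"
      using far S(1) x by (auto simp: independent_set_def)
    from max[OF this] far show False by blast
  qed
  with S that show thesis by blast
qed

lemma card_le_independence_number:
  assumes "fin_digraph G" "independent_set G S"
  shows "card S \<le> independence_number G"
proof -
  interpret fin_digraph G by fact
  have "finite {S. independent_set G S}"
    by (rule finite_subset[of _ "Pow (verts G)"]) (auto simp: independent_set_def)
  with assms(2) show ?thesis
    unfolding independence_number_def by (auto intro: Max_ge)
qed

text \<open>A cop's route must be defined at all times, so the walk is made infinite: having arrived
  at \<open>v\<close>, it stays there.\<close>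

lemma reachable_lazy_walk:
  assumes "wf_digraph G" "u \<rightarrow>\<^sup>*\<^bsub>G\<^esub> v"
  obtains w L where "w 0 = u" "w L = v" "\<And>n::nat. gdist G (w n) (w (Suc n)) \<le> 1"
proof -
  interpret wf_digraph G by fact
  note d1 = gdist_le_1_iff[OF wf_digraph_axioms]
  have "\<exists>w L. w 0 = u \<and> w L = v \<and> (\<forall>n::nat. gdist G (w n) (w (Suc n)) \<le> 1)"
    using assms(2)
  proof (induction rule: converse_reachable_induct)
    case base
    then show ?case by (intro exI[of _ "\<lambda>_. v"]) (auto simp: d1)
  next
    case (step x y)
    then obtain w L where w: "w 0 = y" "w L = v" "\<forall>n::nat. gdist G (w n) (w (Suc n)) \<le> 1"
      by blast
    have "gdist G (case_nat x w n) (case_nat x w (Suc n)) \<le> 1" for n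
      using w step.hyps(1) adj_in_verts(1) by (cases n) (auto simp: d1)
    with w(2) show ?case
      by (intro exI[of _ "case_nat x w"] exI[of _ "Suc L"]) auto
  qed
  with that show thesis by blast
qed

text \<open>
  The cops may follow routes \<open>c\<close> fixed in advance: as soon as the robber comes next to a cop,
  that cop steps onto the robber and stays there, so that its moves remain legal forever.
\<close>
lemma cops_win_if_routes:
  assumes G: "wf_digraph G"
    and start: "\<And>i. i < k \<Longrightarrow> c 0 i \<in> verts G"
    and move: "\<And>i n. i < k \<Longrightarrow> gdist G (c n i) (c (Suc n) i) \<le> 1"
    and reach: "\<And>r. robber_play G r \<Longrightarrow> \<exists>n. \<exists>i<k. gdist G (c n i) (r n) \<le> 1"
  shows "cops_win G k"
proof -
  \<comment> \<open>\<open>c m i\<close> is where the route puts cop \<open>i\<close> when the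
    robber arrives at \<open>h ! m\<close>; a hit at \<open>m\<close> lets the cop step onto him in
    reply, hence \<open>m < length h\<close>. The least hit is chosen so that the target never
    changes as the history grows.\<close>
  define hit where "hit h i m \<longleftrightarrow> m < length h \<and> gdist G (c m i) (h ! m) \<le> 1" for h i m
  define s where "s h i = (if \<exists>m. hit h i m then h ! (LEAST m. hit h i m) else c (length h) i)"
    for h i
  have s_hit: "s (map r [0..<n]) i = r m"
    if "gdist G (c m i) (r m) \<le> 1" "\<And>l. l < m \<Longrightarrow> \<not> gdist G (c l i) (r l) \<le> 1" "m < n"
    for r i m n
  proof -
    have "hit (map r [0..<n]) i m"
      using that by (simp add: hit_def)
    moreover have "(LEAST m. hit (map r [0..<n]) i m) = m"
      by (rule Least_equality) (use that in \<open>auto simp: hit_def intro!: leI\<close>)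
    ultimately show ?thesis
      using that(3) by (auto simp: s_def)
  qed
  have s_route: "s (map r [0..<n]) i = c n i"
    if "\<And>l. l < n \<Longrightarrow> \<not> gdist G (c l i) (r l) \<le> 1" for r i n
    using that by (auto simp: s_def hit_def)
  have first: "\<exists>m. m < n \<and> gdist G (c m i) (r m) \<le> 1 \<and>
      (\<forall>l<m. \<not> gdist G (c l i) (r l) \<le> 1)"
    if "\<exists>l<n. gdist G (c l i) (r l) \<le> 1" for r i n
    using that exists_least_iff[of "\<lambda>l. l < n \<and> gdist G (c l i) (r l) \<le> 1"]
    by (metis order.strict_trans)
  have "cop_strategy G k s"
    unfolding cop_strategy_def
  proof (intro conjI allI impI)
    fix i assume "i < k"
    then show "s [] i \<in> verts G" using start by (simp add: s_def hit_def)
  next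
    fix r n i assume r: "robber_play G r" and i: "i < k"
    show "gdist G (s (map r [0..<n]) i) (s (map r [0..<Suc n]) i) \<le> 1"
    \<comment> \<open>Three cases: the cop has left its route earlier and stands still on
      \<open>r m\<close>; it leaves the route now, stepping from \<open>c n i\<close> to
      \<open>r n\<close>; or it follows the route.\<close>
    proof (cases "\<exists>l<n. gdist G (c l i) (r l) \<le> 1")
      case True
      then obtain m where m: "m < n" "gdist G (c m i) (r m) \<le> 1"
        "\<And>l. l < m \<Longrightarrow> \<not> gdist G (c l i) (r l) \<le> 1"
        using first by meson
      have "s (map r [0..<n]) i = r m" "s (map r [0..<Suc n]) i = r m"
        using m by (auto intro!: s_hit simp del: upt_Suc)
      moreover have "r m \<in> verts G" using r by (simp add: robber_play_def)
      ultimately show ?thesis by (simp add: gdist_le_1_iff[OF G] del: upt_Suc)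
    next
      case False
      then have n: "s (map r [0..<n]) i = c n i"
        by (intro s_route) auto
      show ?thesis
      proof (cases "gdist G (c n i) (r n) \<le> 1")
        case True
        then have "s (map r [0..<Suc n]) i = r n"
          using False by (intro s_hit) auto
        with n True show ?thesis by simp
      next
        case not_n: False
        then have "s (map r [0..<Suc n]) i = c (Suc n) i"
          using False by (intro s_route) (auto simp: less_Suc_eq)
        with n move[OF i] show ?thesis by simp
      qed
    qed
  qed
  moreover have "captured k s r" if r: "robber_play G r" for r
  proof -
    obtain n i where "i < k" "gdist G (c n i) (r n) \<le> 1"
      using reach[OF r] by blast
    then obtain m where "gdist G (c m i) (r m) \<le> 1"
        "\<And>l. l < m \<Longrightarrow> \<not> gdist G (c l i) (r l) \<le> 1"
      using first[of "Suc n" i r] by blast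
    then have "s (map r [0..<Suc m]) i = r m"
      by (intro s_hit) auto
    with \<open>i < k\<close> show ?thesis
      unfolding captured_def by blast
  qed
  ultimately show ?thesis
    unfolding cops_win_def by blast
qed

theorem theorem1:
  fixes G :: "('a, 'b) pre_digraph"
  assumes "graph G"
    and "Digraph_Component.connected G"
    and "diameter G \<ge> 4"
  shows "int (cop_number G) \<le> int (independence_number G) - 1"
proof -
  interpret graph G by fact
  note d1 = gdist_le_1_iff[OF wf_digraph_axioms]
  have "diameter G \<ge> enat (Suc 3)"
    using assms(3) by (simp add: numeral_eq_enat)
  then obtain u v where uv: "u \<in> verts G" "v \<in> verts G" "\<not> gdist G u v \<le> enat 3"
    by (rule ex_far_vertices)
  have far: "\<not> gdist G u v \<le> 1"
    using uv(3) order.trans[of "gdist G u v" 1 "enat 3"] by (auto simp: one_enat_def)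
  \<comment> \<open>An edge from the neighbourhood of \<open>u\<close> to that of \<open>v\<close>,
    or a common vertex, would give a walk of length at most 3 from \<open>u\<close> to
    \<open>v\<close>.\<close>
  have no_edge: False
    if "gdist G u x \<le> 1" "gdist G x y \<le> 1" "gdist G v y \<le> 1" for x y
  proof -
    have "gdist G y v \<le> 1"
      using that(3) by (rule gdist_le_1_sym[OF sym_digraph_axioms])
    with that(1,2) have "gdist G u v \<le> enat (1 + 1 + 1)"
      unfolding one_enat_def by (intro gdist_triangle_le[OF wf_digraph_axioms])
    with uv(3) show False by (simp add: numeral_3_eq_3)
  qed
  have "u \<noteq> v" "\<not> u \<rightarrow>\<^bsub>G\<^esub> v" "\<not> v \<rightarrow>\<^bsub>G\<^esub> u"
    using far uv(1) arcs_ends_symmetric[OF sym_arcs] by (auto simp: d1)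
  then have "independent_set G {u, v}"
    using uv adj_not_same by (auto simp: independent_set_def)
  then obtain S where S: "{u, v} \<subseteq> S" "independent_set G S"
    and dom: "\<And>x. x \<in> verts G \<Longrightarrow> \<exists>y\<in>S. gdist G y x \<le> 1"
    using independent_set_extend_dominating[OF assms(1)] by metis
  have SV: "S \<subseteq> verts G" using S(2) by (simp add: independent_set_def)
  then have finS: "finite S" using finite_verts finite_subset by blast
  define a where "a = card (S - {u, v})"
  have card_S: "card S = a + 2"
    unfolding a_def using S(1) finS \<open>u \<noteq> v\<close> card_Diff_subset[of "{u, v}" S]
      card_mono[OF finS S(1)] by simp
  obtain f where f: "bij_betw f {..<a} (S - {u, v})"
    unfolding a_def using ex_bij_betw_nat_finite[of "S - {u, v}"] finS
    by (auto simp: atLeast0LessThan)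
  have "u \<rightarrow>\<^sup>*\<^bsub>G\<^esub> v"
    using symmetric_connected_imp_strongly_connected[OF sym_arcs assms(2)] uv
    by (auto simp: strongly_connected_def)
  then obtain w L where w: "w 0 = u" "w L = v" "\<And>n::nat. gdist G (w n) (w (Suc n)) \<le> 1"
    using reachable_lazy_walk[OF wf_digraph_axioms] by metis
  \<comment> \<open>Cops \<open>0\<close> to \<open>a - 1\<close> guard \<open>S - {u, v}\<close>
    and cop \<open>a\<close> walks, which makes \<open>card S - 1\<close> cops in all.\<close>
  define c where "c n i = (if i < a then f i else w n)" for n i
  have "cops_win G (Suc a)"
  proof (rule cops_win_if_routes[OF wf_digraph_axioms, where c = c])
    fix i assume "i < Suc a"
    show "c 0 i \<in> verts G"
      using bij_betwE[OF f] SV uv w by (auto simp: c_def)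
  next
    fix i n assume "i < Suc a"
    show "gdist G (c n i) (c (Suc n) i) \<le> 1"
      using bij_betwE[OF f] SV w(3) by (auto simp: c_def d1)
  next
    fix r assume r: "robber_play G r"
    show "\<exists>n. \<exists>i<Suc a. gdist G (c n i) (r n) \<le> 1"
    proof (rule ccontr)
      assume "\<not> ?thesis"
      then have safe: "\<not> gdist G (c n i) (r n) \<le> 1" if "i < Suc a" for n i
        using that by blast
      have walker: "\<not> gdist G (w n) (r n) \<le> 1" for n
        using safe[of a n] by (simp add: c_def)
      have near: "gdist G u (r n) \<le> 1 \<or> gdist G v (r n) \<le> 1" for n
      proof -
        obtain y where y: "y \<in> S" "gdist G y (r n) \<le> 1"
          using dom r unfolding robber_play_def by blast
        have "y \<notin> S - {u, v}"
        proof
          assume "y \<in> S - {u, v}"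
          then obtain i where "i < a" "f i = y"
            using bij_betw_imp_surj_on[OF f] by (metis imageE lessThan_iff)
          with safe[of i n] y(2) show False by (simp add: c_def)
        qed
        with y show ?thesis by auto
      qed
      \<comment> \<open>At time 0 the walker stands on \<open>u\<close>, so the robber must start
        near \<open>v\<close>; afterwards \<open>no_edge\<close>, applied to his move read
        backwards, keeps him there.\<close>
      have "gdist G v (r n) \<le> 1" for n
      proof (induction n)
        case 0
        show ?case using near[of 0] walker[of 0] w(1) by simp
      next
        case (Suc n)
        have "gdist G (r n) (r (Suc n)) \<le> 1"
          using r by (simp add: robber_play_def)
        then have "gdist G (r (Suc n)) (r n) \<le> 1"
          by (rule gdist_le_1_sym[OF sym_digraph_axioms])
        with Suc no_edge near[of "Suc n"] show ?case by blast
      qed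
      \<comment> \<open>At time \<open>L\<close> the walker is on \<open>v\<close>, hence within
        reach of the robber.\<close>
      with walker[of L] w(2) show False by simp
    qed
  qed
  then have "cop_number G \<le> Suc a"
    unfolding cop_number_def by (rule Least_le)
  moreover have "a + 2 \<le> independence_number G"
    using card_le_independence_number[OF fin_digraph_axioms S(2)] card_S by simp
  ultimately show ?thesis by simp
qed

end
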